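(* For every fixed integer $r\ge 9$ and every real number $M>0$, there exist a finite abelian group $G$ of rank $r$ and a zero-sum-free sequence $S$ over $G$ such that $|S|=\mathsf d^*(G)$ and $\mathsf k(S)>M$. In particular, the following assertion is false: for every finite abelian group $G= C_{n_1}\oplus\cdots\oplus C_{n_r}$ with $1<n_1\mid\cdots\mid n_r$, every zero-sum-free sequence $S$ over $G$ with $|S|\ge\mathsf d^*(G)$ satisfies $\mathsf k(S)\le\sum_{i=1}^r\frac{n_i-1}{n_i}$.
   Context: All groups are finite, abelian and written additively; $C_n$ denotes the cyclic group of order $n$. The rank of a group is its minimum number of generators. A sequence $S=g_1\cdots g_\ell$ over $G$ is a finite unordered multiset of elements of $G$ of length $|S|=\ell$ (counted with multiplicity). It is zero-sum free if no nonempty subsequence (sub-multiset) has sum $0$; in particular its terms are nonzero. The cross number of a sequence $S=g_1\cdots g_\ell$ of nonzero elements is $\mathsf k(S)=\sum_{i=1}^\ell \frac{1}{\operatorname{ord}(g_i)}$. If $G\cong C_{n_1}\oplus\cdots\oplus C_{n_s}$ with $1<n_1\mid\cdots\mid n_s$, then $\mathsf d^*(G)=\sum_{i=1}^s(n_i-1)$. *)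

theory Defs
  imports Complex_Main "HOL-Library.Multiset" "HOL-Algebra.Algebra"
begin

text \<open>
  Finite abelian groups are the \<open>comm_group\<close>s of \<open>HOL-Algebra\<close> with finite carrier. That library
  writes groups multiplicatively, so the neutral element \<open>0\<close> of an additively written group is
  \<open>\<one>\<^bsub>G\<^esub>\<close>, and \<open>k g\<close> is \<open>g [^]\<^bsub>G\<^esub> k\<close>.
\<close>

definition group_rank :: "('a, 'b) monoid_scheme \<Rightarrow> nat" where
  "group_rank G =
     (LEAST k. \<exists>A. A \<subseteq> carrier G \<and> finite A \<and> card A = k \<and> generate G A = carrier G)"

text \<open>A list \<open>[n\<^sub>1, \<dots>, n\<^sub>s]\<close> with \<open>1 < n\<^sub>1 dvd \<dots> dvd n\<^sub>s\<close>; the empty list belongs to the trivial group.\<close>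

definition invariant_chain :: "nat list \<Rightarrow> bool" where
  "invariant_chain ns \<longleftrightarrow> (\<forall>n \<in> set ns. 1 < n) \<and> sorted_wrt (dvd) ns"

definition cyclic_sum :: "nat list \<Rightarrow> (nat \<Rightarrow> int) monoid" where
  "cyclic_sum ns = product_group {..<length ns} (\<lambda>i. integer_mod_group (ns ! i))"

text \<open>
  Every finite abelian group is isomorphic to \<open>cyclic_sum ns\<close> for exactly one \<open>invariant_chain\<close>
  \<open>ns\<close>, so the description below determines a number.
\<close>

definition d_star :: "('a, 'b) monoid_scheme \<Rightarrow> nat" where
  "d_star G =
     (THE d. \<exists>ns. invariant_chain ns \<and> G \<cong> cyclic_sum ns \<and> d = (\<Sum>n\<leftarrow>ns. n - 1))"

text \<open>A sequence over \<open>G\<close> is a multiset of elements of the carrier; its length is \<open>size S\<close>.\<close>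

definition seq_over :: "('a, 'b) monoid_scheme \<Rightarrow> 'a multiset \<Rightarrow> bool" where
  "seq_over G S \<longleftrightarrow> set_mset S \<subseteq> carrier G"

definition seq_sum :: "('a, 'b) monoid_scheme \<Rightarrow> 'a multiset \<Rightarrow> 'a" where
  "seq_sum G S = (\<Otimes>\<^bsub>G\<^esub>g\<in>set_mset S. g [^]\<^bsub>G\<^esub> count S g)"

definition zero_sum_free :: "('a, 'b) monoid_scheme \<Rightarrow> 'a multiset \<Rightarrow> bool" where
  "zero_sum_free G S \<longleftrightarrow>
     seq_over G S \<and> (\<forall>T. T \<subseteq># S \<and> T \<noteq> {#} \<longrightarrow> seq_sum G T \<noteq> \<one>\<^bsub>G\<^esub>)"

definition cross_number :: "('a, 'b) monoid_scheme \<Rightarrow> 'a multiset \<Rightarrow> real" where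
  "cross_number G S = (\<Sum>g\<in>#S. 1 / real (group.ord G g))"

end

theory Submission
  imports Defs
begin

text \<open>
  The group \<open>H = C\<^sub>3\<^sup>3 \<oplus> C\<^sub>6\<close> carries a zero-sum free sequence of length \<open>12 = d\<^sup>*(H) + 1\<close> with only
  seven distinct terms \<open>h\<^sub>j\<close>, of multiplicity \<open>a\<^sub>j\<close>. Identify \<open>H\<close> with \<open>m G'\<close> for
  \<open>G' = C\<^sub>m\<^bsup>s - 4\<^esup> \<oplus> C\<^sub>3\<^sub>m\<^sup>3 \<oplus> C\<^sub>6\<^sub>m\<close> with \<open>s \<ge> 7\<close>, pad the \<open>h\<^sub>j\<close> by zeros of multiplicity 0
  to \<open>s\<close> terms, and choose \<open>g\<^sub>j\<close> with \<open>m g\<^sub>j = h\<^sub>j\<close> that form a basis of \<open>G' / m G'\<close>. A zero sum of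
  the \<open>g\<^sub>j\<close> has all coefficients divisible by \<open>m\<close>, so taking \<open>g\<^sub>j\<close> with multiplicity
  \<open>a\<^sub>j m + m - 1\<close> is again zero-sum free, and its length exceeds \<open>d\<^sup>*(G')\<close> by \<open>m\<close>. Hence it has
  length \<open>d\<^sup>*(C\<^sub>m \<oplus> G') + 1\<close> without using the first summand. If \<open>m\<close> is a product of distinct
  primes \<open>p\<close>, that summand has room for \<open>p - 1\<close> copies of an element of order \<open>p\<close> for every \<open>p\<close>,
  which contribute the unbounded amount \<open>\<Sum> (p - 1) / p\<close> to the cross number; surplus terms of the
  long sequence are dropped to reach the length \<open>d\<^sup>*\<close> exactly.
\<close>

section \<open>Divisor chains determined by products of gcds\<close>

text \<open>After division by the gcd \<open>g\<close>, coprimality turns the condition into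
  \<open>n' dvd y\<close>, which leaves the \<open>g\<close> multiples of \<open>n'\<close> below
  \<open>n\<close>. This counts the k-torsion of a cyclic group.\<close>

lemma card_multiples_annihilated:
  fixes n k :: nat
  assumes "n > 0"
  shows "card {y \<in> {0..<int n}. int n dvd int k * y} = gcd k n"
proof -
  define g where "g = gcd k n"
  obtain k' n' where kn: "k = k' * g" "n = n' * g" "coprime k' n'"
    using assms gcd_coprime_exists[of k n] unfolding g_def by auto
  have g: "g > 0" "n' > 0" using assms kn by auto
  have "{y \<in> {0..<int n}. int n dvd int k * y} = (\<lambda>t. int n' * t) ` {0..<int g}" (is "?L = ?R")
  proof
    show "?L \<subseteq> ?R"
    proof
      fix y assume y: "y \<in> ?L"
      have "int g * int n' dvd int g * (int k' * y)" using y kn by (simp add: ac_simps)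
      then have "int n' dvd int k' * y" using g by simp
      then have "int n' dvd y"
        using kn(3) by (metis coprime_commute coprime_dvd_mult_right_iff coprime_int_iff)
      then obtain t where t: "y = int n' * t" by blast
      have "int n' * t < int n' * int g" "0 \<le> int n' * t" using y kn t by auto
      then have "t \<in> {0..<int g}" using g by (auto simp: zero_le_mult_iff)
      then show "y \<in> ?R" using t by blast
    qed
    show "?R \<subseteq> ?L"
      using kn g by (auto simp: mult.assoc)
  qed
  moreover have "inj_on (\<lambda>t. int n' * t) {0..<int g}" using g by (auto simp: inj_on_def)
  ultimately show ?thesis by (simp add: card_image g_def)
qed

lemma prod_list_gcd_le:
  fixes k :: nat
  assumes "k > 0"
  shows "prod_list (map (gcd k) ns) \<le> k ^ length ns"
  by (induction ns) (use assms in \<open>auto intro!: mult_le_mono gcd_le1_nat\<close>)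

lemma prod_list_gcd_eq:
  fixes k :: nat
  assumes "\<forall>n \<in> set ns. k dvd n"
  shows "prod_list (map (gcd k) ns) = k ^ length ns"
  using assms by (induction ns) (auto simp: gcd_nat.absorb1)

text \<open>At \<open>k = n\<close> the product for \<open>n # ns\<close> reaches the largest value
  possible for its length, so the gcd with \<open>n'\<close> in the other product must be
  \<open>n\<close> as well.\<close>

lemma chain_hd_dvd:
  fixes n n' :: nat
  assumes "n > 0" "\<forall>x \<in> set ns. n dvd x" "length ns = length ns'"
    and "prod_list (map (gcd n) (n # ns)) = prod_list (map (gcd n) (n' # ns'))"
  shows "n dvd n'"
proof -
  have "n * n ^ length ns = gcd n n' * prod_list (map (gcd n) ns')"
    using assms(4) prod_list_gcd_eq[OF assms(2)] by simp
  also have "\<dots> \<le> gcd n n' * n ^ length ns"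
    using prod_list_gcd_le[OF assms(1), of ns'] assms(3) by simp
  finally have "n \<le> gcd n n'" using assms(1) by simp
  then have "gcd n n' = n" using assms(1) by (simp add: antisym gcd_le1_nat)
  then show ?thesis by (metis gcd_dvd2)
qed

text \<open>The heads divide each other by \<open>chain_hd_dvd\<close>, applied in both directions.
  Their common positive gcd with \<open>k\<close> then cancels, and induction applies to the
  tails.\<close>

lemma dvd_chain_unique:
  fixes ns ns' :: "nat list"
  assumes "length ns = length ns'" "\<forall>n \<in> set ns. 0 < n" "sorted_wrt (dvd) ns"
    and "\<forall>n \<in> set ns'. 0 < n" "sorted_wrt (dvd) ns'"
    and "\<And>k. prod_list (map (gcd k) ns) = prod_list (map (gcd k) ns')"
  shows "ns = ns'"
  using assms
proof (induction ns ns' rule: list_induct2)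
  case (Cons n ns n' ns')
  have "n dvd n'"
    by (rule chain_hd_dvd[OF _ _ _ Cons.prems(5)[of n]]) (use Cons.prems(1,2) Cons.hyps in auto)
  moreover have "n' dvd n"
    by (rule chain_hd_dvd[OF _ _ _ Cons.prems(5)[of n', symmetric]]) (use Cons.prems(3,4) Cons.hyps in auto)
  ultimately have eq: "n = n'" by (simp add: dvd_antisym)
  have "prod_list (map (gcd k) ns) = prod_list (map (gcd k) ns')" for k
    using Cons.prems(5)[of k] Cons.prems(1) eq by simp
  then show ?case using Cons eq by simp
qed simp

text \<open>Take \<open>k\<close> to be the head \<open>n\<close>: one side is
  \<open>n ^ length ns\<close>, the other at most \<open>n ^ length ns'\<close>, and
  \<open>n > 1\<close> lets the exponents be compared.\<close>

lemma invariant_chain_length_le: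
  assumes "invariant_chain ns"
    and "\<And>k. prod_list (map (gcd k) ns) = prod_list (map (gcd k) ns')"
  shows "length ns \<le> length ns'"
proof (cases ns)
  case (Cons n xs)
  then have n: "n > 1" "\<forall>x \<in> set ns. n dvd x" using assms(1) by (auto simp: invariant_chain_def)
  have "n ^ length ns \<le> n ^ length ns'"
    using prod_list_gcd_eq[OF n(2)] prod_list_gcd_le[of n ns'] assms(2)[of n] n(1) by simp
  then show ?thesis using n(1) by simp
qed simp

lemma invariant_chain_unique:
  assumes "invariant_chain ns" "invariant_chain ns'"
    and "\<And>k. prod_list (map (gcd k) ns) = prod_list (map (gcd k) ns')"
  shows "ns = ns'"
proof (rule dvd_chain_unique[OF _ _ _ _ _ assms(3)])
  show "length ns = length ns'"
    using invariant_chain_length_le[OF assms(1), of ns'] invariant_chain_length_le[OF assms(2), of ns]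
      assms(3) by (simp add: antisym)
qed (use assms in \<open>auto simp: invariant_chain_def\<close>)

section \<open>Torsion in sums of cyclic groups and the value of d*\<close>

lemma comm_group_cyclic_sum: "comm_group (cyclic_sum ns)"
  unfolding cyclic_sum_def
  by (rule group.group_comm_groupI) (auto intro!: product_group simp: add.commute)

lemma carrier_cyclic_sum:
  assumes "\<forall>n \<in> set ns. 0 < n"
  shows "carrier (cyclic_sum ns) = (\<Pi>\<^sub>E i\<in>{..<length ns}. {0..<int (ns ! i)})"
  unfolding cyclic_sum_def carrier_product_group
proof (rule PiE_cong)
  fix i assume "i \<in> {..<length ns}"
  then have "ns ! i \<noteq> 0" using assms by fastforce
  then show "carrier (integer_mod_group (ns ! i)) = {0..<int (ns ! i)}"
    by (simp add: carrier_integer_mod_group)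
qed

lemma one_cyclic_sum: "\<one>\<^bsub>cyclic_sum ns\<^esub> = (\<lambda>i\<in>{..<length ns}. 0)"
  by (simp add: cyclic_sum_def)

lemma mult_cyclic_sum:
  "x \<otimes>\<^bsub>cyclic_sum ns\<^esub> y = (\<lambda>i\<in>{..<length ns}. (x i + y i) mod int (ns ! i))"
  by (simp add: cyclic_sum_def)

lemma finite_cyclic_sum:
  assumes "\<forall>n \<in> set ns. 0 < n"
  shows "finite (carrier (cyclic_sum ns))"
  by (simp add: carrier_cyclic_sum[OF assms] finite_PiE)

lemma pow_cyclic_sum:
  "x [^]\<^bsub>cyclic_sum ns\<^esub> (k::nat) = (\<lambda>i\<in>{..<length ns}. (int k * x i) mod int (ns ! i))"
proof (induction k)
  case (Suc k)
  then show ?case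
    by (auto simp: mult_cyclic_sum mod_simps algebra_simps intro!: restrict_ext)
qed (simp add: one_cyclic_sum)

lemma restrict_mod_eq_zero_iff:
  "(\<lambda>i\<in>I. (f i :: int) mod g i) = (\<lambda>i\<in>I. 0) \<longleftrightarrow> (\<forall>i\<in>I. g i dvd f i)"
  by (auto simp: fun_eq_iff dvd_eq_mod_eq_0 restrict_def split: if_splits)

text \<open>Torsion is tested coordinatewise, so the count is a product over the summands. These
  counts are isomorphism invariants, which makes the invariant factors unique.\<close>

lemma card_torsion_cyclic_sum:
  assumes "\<forall>n \<in> set ns. 0 < n"
  shows "card {x \<in> carrier (cyclic_sum ns). x [^]\<^bsub>cyclic_sum ns\<^esub> k = \<one>\<^bsub>cyclic_sum ns\<^esub>} =
    prod_list (map (gcd k) ns)"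
proof -
  have "{x \<in> carrier (cyclic_sum ns). x [^]\<^bsub>cyclic_sum ns\<^esub> k = \<one>\<^bsub>cyclic_sum ns\<^esub>} =
    (\<Pi>\<^sub>E i\<in>{..<length ns}. {y \<in> {0..<int (ns ! i)}. int (ns ! i) dvd int k * y})"
    unfolding carrier_cyclic_sum[OF assms] pow_cyclic_sum one_cyclic_sum restrict_mod_eq_zero_iff
    by (rule Set.set_eqI) (unfold mem_Collect_eq PiE_iff, blast)
  moreover have "card {y \<in> {0..<int (ns ! i)}. int (ns ! i) dvd int k * y} = gcd k (ns ! i)"
    if "i < length ns" for i
    by (rule card_multiples_annihilated) (use assms that in simp)
  ultimately have "card {x \<in> carrier (cyclic_sum ns). x [^]\<^bsub>cyclic_sum ns\<^esub> k = \<one>\<^bsub>cyclic_sum ns\<^esub>} =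
    (\<Prod>i<length ns. gcd k (ns ! i))"
    by (simp only: card_PiE finite_lessThan) (rule prod.cong, auto)
  then show ?thesis
    by (simp add: prod.list_conv_set_nth atLeast0LessThan)
qed

lemma card_torsion_iso:
  assumes "group G" "group H" "G \<cong> H"
  shows "card {x \<in> carrier G. x [^]\<^bsub>G\<^esub> (k::nat) = \<one>\<^bsub>G\<^esub>} =
    card {x \<in> carrier H. x [^]\<^bsub>H\<^esub> k = \<one>\<^bsub>H\<^esub>}"
proof -
  obtain f where f: "f \<in> iso G H" using assms(3) by (auto simp: is_iso_def)
  interpret group_hom G H f
    using f assms by (simp add: group_hom_def group_hom_axioms_def iso_def)
  have bij: "bij_betw f (carrier G) (carrier H)" using f by (simp add: iso_def)
  have *: "f x [^]\<^bsub>H\<^esub> k = \<one>\<^bsub>H\<^esub> \<longleftrightarrow> x [^]\<^bsub>G\<^esub> k = \<one>\<^bsub>G\<^esub>" if "x \<in> carrier G" for x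
    using that bij by (metis G.nat_pow_closed G.one_closed bij_betw_def hom_nat_pow hom_one inj_on_def)
  have "bij_betw f {x \<in> carrier G. x [^]\<^bsub>G\<^esub> k = \<one>\<^bsub>G\<^esub>} {x \<in> carrier H. x [^]\<^bsub>H\<^esub> k = \<one>\<^bsub>H\<^esub>}"
    unfolding bij_betw_def
  proof
    show "inj_on f {x \<in> carrier G. x [^]\<^bsub>G\<^esub> k = \<one>\<^bsub>G\<^esub>}"
      using bij by (auto simp: bij_betw_def inj_on_def)
    show "f ` {x \<in> carrier G. x [^]\<^bsub>G\<^esub> k = \<one>\<^bsub>G\<^esub>} = {x \<in> carrier H. x [^]\<^bsub>H\<^esub> k = \<one>\<^bsub>H\<^esub>}"
      unfolding bij_betw_imp_surj_on[OF bij, symmetric] using * by auto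
  qed
  then show ?thesis by (rule bij_betw_same_card)
qed

lemma invariant_chain_pos: "invariant_chain ns \<Longrightarrow> \<forall>n \<in> set ns. 0 < n"
  by (auto simp: invariant_chain_def)

text \<open>The definite description needs uniqueness: an isomorphic sum has the same torsion
  counts, hence the same chain.\<close>

lemma d_star_cyclic_sum:
  assumes "invariant_chain ns"
  shows "d_star (cyclic_sum ns) = (\<Sum>n\<leftarrow>ns. n - 1)"
  unfolding d_star_def
proof (rule the_equality)
  show "\<exists>ms. invariant_chain ms \<and> cyclic_sum ns \<cong> cyclic_sum ms \<and> (\<Sum>n\<leftarrow>ns. n - 1) = (\<Sum>n\<leftarrow>ms. n - 1)"
    using assms iso_refl by blast
next
  fix d assume "\<exists>ms. invariant_chain ms \<and> cyclic_sum ns \<cong> cyclic_sum ms \<and> d = (\<Sum>n\<leftarrow>ms. n - 1)"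
  then obtain ms where ms: "invariant_chain ms" "cyclic_sum ns \<cong> cyclic_sum ms" "d = (\<Sum>n\<leftarrow>ms. n - 1)"
    by blast
  have "prod_list (map (gcd k) ns) = prod_list (map (gcd k) ms)" for k
    unfolding card_torsion_cyclic_sum[OF invariant_chain_pos[OF assms], symmetric]
      card_torsion_cyclic_sum[OF invariant_chain_pos[OF ms(1)], symmetric]
    by (rule card_torsion_iso[OF _ _ ms(2)]) (rule comm_group.axioms(2)[OF comm_group_cyclic_sum])+
  then show "d = (\<Sum>n\<leftarrow>ns. n - 1)" using invariant_chain_unique[OF assms ms(1)] ms(3) by simp
qed

section \<open>Lower bound for the rank\<close>

text \<open>Modulo \<open>p\<close> every generated element is an integer combination of
  \<open>A\<close>, giving at most \<open>p ^ card A\<close> residue vectors, while the whole group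
  has \<open>p ^ length ns\<close> of them.\<close>

lemma rank_lower_bound:
  assumes pos: "\<forall>n \<in> set ns. 0 < n" and p: "p > 1" "\<forall>n \<in> set ns. p dvd n"
    and A: "A \<subseteq> carrier (cyclic_sum ns)" "finite A" "generate (cyclic_sum ns) A = carrier (cyclic_sum ns)"
  shows "length ns \<le> card A"
proof -
  let ?I = "{..<length ns}"
  let ?P = "\<lambda>e. \<lambda>i\<in>?I. (\<Sum>a\<in>A. e a * a i) mod int p"
  have dv: "int p dvd int (ns ! i)" if "i < length ns" for i
    using p that by auto
  have comb: "\<exists>e. \<forall>i<length ns. x i mod int p = (\<Sum>a\<in>A. e a * a i) mod int p"
    if "x \<in> generate (cyclic_sum ns) A" for x
    using that
  proof induction
    case one
    show ?case by (rule exI[of _ "\<lambda>_. 0"]) (simp add: one_cyclic_sum)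
  next
    case (incl h)
    then show ?case
      using A(2) by (intro exI[of _ "\<lambda>a. if a = h then 1 else 0"])
        (simp add: if_distrib[of "\<lambda>x. x * _"] cong: if_cong)
  next
    case (inv h)
    have "h \<in> carrier (product_group ?I (\<lambda>i. integer_mod_group (ns ! i)))"
      using inv A(1) by (auto simp: cyclic_sum_def)
    then have "inv\<^bsub>cyclic_sum ns\<^esub> h = (\<lambda>i\<in>?I. (- h i) mod int (ns ! i))"
      by (auto simp: cyclic_sum_def PiE_iff intro!: restrict_ext)
    then show ?case
      using A(2) inv dv by (intro exI[of _ "\<lambda>a. if a = h then - 1 else 0"])
        (simp add: if_distrib[of "\<lambda>x. x * _"] mod_mod_cancel cong: if_cong)
  next
    case (eng x y)
    then obtain e f where ef: "\<forall>i<length ns. x i mod int p = (\<Sum>a\<in>A. e a * a i) mod int p"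
      "\<forall>i<length ns. y i mod int p = (\<Sum>a\<in>A. f a * a i) mod int p" by blast
    have *: "(x \<otimes>\<^bsub>cyclic_sum ns\<^esub> y) i mod int p = (\<Sum>a\<in>A. (e a + f a) * a i) mod int p"
      if "i < length ns" for i
    proof -
      have "(x \<otimes>\<^bsub>cyclic_sum ns\<^esub> y) i mod int p = (x i + y i) mod int p"
        using that by (simp add: mult_cyclic_sum mod_mod_cancel[OF dv[OF that]])
      also have "\<dots> = (x i mod int p + y i mod int p) mod int p" by (simp only: mod_add_eq)
      also have "\<dots> = ((\<Sum>a\<in>A. e a * a i) + (\<Sum>a\<in>A. f a * a i)) mod int p"
        using ef that by (simp only: mod_add_eq)
      finally show ?thesis by (simp only: distrib_right sum.distrib)
    qed
    show ?case by (rule exI[of _ "\<lambda>a. e a + f a"]) (intro allI impI *)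
  qed
  have "(\<Pi>\<^sub>E i\<in>?I. {0..<int p}) \<subseteq> ?P ` (\<Pi>\<^sub>E a\<in>A. {0..<int p})"
  proof
    fix x assume x: "x \<in> (\<Pi>\<^sub>E i\<in>?I. {0..<int p})"
    have x_lt: "x i \<in> {0..<int p}" if "i < length ns" for i
      using x that by (simp add: PiE_iff)
    \<comment> \<open>Entries below \<open>p\<close> are already reduced modulo each
      \<open>ns ! i\<close>, so \<open>x\<close> itself is a group element.\<close>
    have "x \<in> (\<Pi>\<^sub>E i\<in>?I. {0..<int (ns ! i)})"
    proof (rule PiE_I)
      fix i assume "i \<in> ?I"
      then have i: "i < length ns" by simp
      have "p \<le> ns ! i" using p(2) pos i by (simp add: dvd_imp_le)
      then show "x i \<in> {0..<int (ns ! i)}" using x_lt[OF i] by simp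
    qed (use x in \<open>simp add: PiE_iff extensional_def\<close>)
    then have "x \<in> generate (cyclic_sum ns) A" using A(3) carrier_cyclic_sum[OF pos] by simp
    then obtain e where e: "\<forall>i<length ns. x i mod int p = (\<Sum>a\<in>A. e a * a i) mod int p"
      using comb by auto
    \<comment> \<open>Reducing the coefficients modulo \<open>p\<close> preserves the combination
      modulo \<open>p\<close> and confines them to a box of \<open>p ^ card A\<close>
      elements.\<close>
    let ?e = "\<lambda>a\<in>A. e a mod int p"
    have "(\<Sum>a\<in>A. ?e a * a i) mod int p = (\<Sum>a\<in>A. e a * a i) mod int p" for i
    proof -
      have "(\<Sum>a\<in>A. ?e a * a i) mod int p = (\<Sum>a\<in>A. (?e a * a i) mod int p) mod int p"
        by (simp add: mod_sum_eq)
      also have "\<dots> = (\<Sum>a\<in>A. (e a * a i) mod int p) mod int p"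
        by (rule arg_cong[of _ _ "\<lambda>x. x mod int p"], rule sum.cong[OF refl]) (simp add: mod_mult_left_eq)
      finally show ?thesis by (simp add: mod_sum_eq)
    qed
    note e_mod = this
    have "x = ?P ?e"
    proof
      fix i
      show "x i = ?P ?e i"
      proof (cases "i < length ns")
        case True
        then have "x i = x i mod int p" using x_lt by simp
        then show ?thesis using True e e_mod[of i] by simp
      qed (use x in \<open>simp add: PiE_iff extensional_def\<close>)
    qed
    moreover have "?e \<in> (\<Pi>\<^sub>E a\<in>A. {0..<int p})" using p by auto
    ultimately show "x \<in> ?P ` (\<Pi>\<^sub>E a\<in>A. {0..<int p})" by blast
  qed
  then have "card (\<Pi>\<^sub>E i\<in>?I. {0..<int p}) \<le> card (\<Pi>\<^sub>E a\<in>A. {0..<int p})"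
    by (rule surj_card_le[rotated]) (simp add: finite_PiE A(2))
  then have "p ^ length ns \<le> p ^ card A" using A(2) by (simp add: card_PiE)
  then show ?thesis using p(1) by simp
qed

section \<open>Sequence sums as integer linear forms\<close>

text \<open>\<open>seq_sum\<close> collects equal terms into powers; isolating the power of
  \<open>g\<close> yields the recursion for induction over multisets.\<close>

lemma (in comm_group) seq_sum_add_mset:
  assumes "g \<in> carrier G" "set_mset T \<subseteq> carrier G"
  shows "seq_sum G (add_mset g T) = g \<otimes> seq_sum G T"
proof -
  let ?F = "set_mset T - {g}"
  let ?p = "finprod G (\<lambda>h. h [^] count T h) ?F"
  have F: "finite ?F" "g \<notin> ?F" by auto
  have p: "?p \<in> carrier G" using assms(2) by (intro finprod_closed) auto
  have "set_mset (add_mset g T) = insert g ?F" by auto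
  then have "seq_sum G (add_mset g T) = finprod G (\<lambda>h. h [^] count (add_mset g T) h) (insert g ?F)"
    unfolding seq_sum_def by (rule arg_cong)
  also have "\<dots> = g [^] Suc (count T g) \<otimes> finprod G (\<lambda>h. h [^] count (add_mset g T) h) ?F"
    using assms by (subst finprod_insert[OF F]) auto
  also have "finprod G (\<lambda>h. h [^] count (add_mset g T) h) ?F = ?p"
    using assms(2) by (intro finprod_cong') auto
  finally have *: "seq_sum G (add_mset g T) = g [^] Suc (count T g) \<otimes> ?p" .
  have "seq_sum G T = g [^] count T g \<otimes> ?p"
  proof (cases "g \<in># T")
    case True
    then have "set_mset T = insert g ?F" by auto
    then have "seq_sum G T = finprod G (\<lambda>h. h [^] count T h) (insert g ?F)"
      unfolding seq_sum_def by (rule arg_cong)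
    also have "\<dots> = g [^] count T g \<otimes> ?p" using assms by (subst finprod_insert[OF F]) auto
    finally show ?thesis .
  next
    case False
    then have "count T g = 0" "?F = set_mset T" by (auto simp: not_in_iff)
    then show ?thesis using p by (simp add: seq_sum_def)
  qed
  then show ?thesis unfolding * using assms(1) p
    by (simp add: m_assoc m_lcomm)
qed

text \<open>Lets arbitrary integer vectors represent group elements, so that vanishing becomes
  divisibility in each coordinate.\<close>

definition residues :: "nat list \<Rightarrow> (nat \<Rightarrow> int) \<Rightarrow> nat \<Rightarrow> int" where
  "residues ns v = (\<lambda>i\<in>{..<length ns}. v i mod int (ns ! i))"

lemma residues_closed:
  assumes "\<forall>n \<in> set ns. 0 < n"
  shows "residues ns v \<in> carrier (cyclic_sum ns)"
  using assms by (auto simp: carrier_cyclic_sum residues_def)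

lemma residues_add:
  "residues ns v \<otimes>\<^bsub>cyclic_sum ns\<^esub> residues ns w = residues ns (\<lambda>i. v i + w i)"
  by (auto simp: mult_cyclic_sum residues_def mod_simps intro!: restrict_ext)

lemma residues_pow:
  "residues ns v [^]\<^bsub>cyclic_sum ns\<^esub> (k::nat) = residues ns (\<lambda>i. int k * v i)"
  by (auto simp: pow_cyclic_sum residues_def mod_simps intro!: restrict_ext)

lemma residues_eq_one_iff:
  "residues ns v = \<one>\<^bsub>cyclic_sum ns\<^esub> \<longleftrightarrow> (\<forall>i<length ns. int (ns ! i) dvd v i)"
  unfolding residues_def one_cyclic_sum restrict_mod_eq_zero_iff by auto

lemma residues_carrier:
  assumes "\<forall>n \<in> set ns. 0 < n" "x \<in> carrier (cyclic_sum ns)"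
  shows "residues ns x = x"
  using assms(2) unfolding carrier_cyclic_sum[OF assms(1)] residues_def
  by (auto simp: PiE_iff fun_eq_iff extensional_def)

text \<open>
  A sequence over \<open>cyclic_sum ns\<close> is handled through an additive map \<open>L\<close> on coefficient functions:
  \<open>L b i\<close> is the \<open>i\<close>-th coordinate of \<open>\<Sum> b\<^sub>k g\<^sub>k\<close>, and \<open>g\<^sub>k\<close> is recovered as the image of the
  \<open>k\<close>-th unit vector.
\<close>

definition linear_map :: "(('b \<Rightarrow> int) \<Rightarrow> nat \<Rightarrow> int) \<Rightarrow> bool" where
  "linear_map L \<longleftrightarrow> (\<forall>b c. L (\<lambda>k. b k + c k) = (\<lambda>i. L b i + L c i))"

lemma linear_map_add: "linear_map L \<Longrightarrow> L (\<lambda>k. b k + c k) = (\<lambda>i. L b i + L c i)"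
  by (simp add: linear_map_def)

definition generator :: "nat list \<Rightarrow> (('b \<Rightarrow> int) \<Rightarrow> nat \<Rightarrow> int) \<Rightarrow> 'b \<Rightarrow> nat \<Rightarrow> int" where
  "generator ns L k = residues ns (L (\<lambda>j. if j = k then 1 else 0))"

lemma seq_sum_generators:
  assumes "\<forall>n \<in> set ns. 0 < n" "linear_map L"
  shows "seq_sum (cyclic_sum ns) (image_mset (generator ns L) K) = residues ns (L (\<lambda>k. int (count K k)))"
proof (induction K)
  case empty
  have "L (\<lambda>k. 0) i = 0" for i
    using linear_map_add[OF assms(2), of "\<lambda>k. 0" "\<lambda>k. 0"] by (simp add: fun_eq_iff)
  moreover have "seq_sum (cyclic_sum ns) {#} = \<one>\<^bsub>cyclic_sum ns\<^esub>"
    using comm_monoid.finprod_empty[OF comm_group.axioms(1)[OF comm_group_cyclic_sum]]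
    by (simp add: seq_sum_def)
  ultimately show ?case by (simp add: residues_eq_one_iff[THEN iffD2])
next
  case (add k K)
  interpret comm_group "cyclic_sum ns" by (rule comm_group_cyclic_sum)
  have "(\<lambda>j. int (count (add_mset k K) j)) = (\<lambda>j. (if j = k then 1 else 0) + int (count K j))"
    by auto
  then have "L (\<lambda>j. int (count (add_mset k K) j)) =
      (\<lambda>i. L (\<lambda>j. if j = k then 1 else 0) i + L (\<lambda>j. int (count K j)) i)"
    by (simp only: linear_map_add[OF assms(2)])
  moreover have "seq_sum (cyclic_sum ns) (image_mset (generator ns L) (add_mset k K)) =
      generator ns L k \<otimes>\<^bsub>cyclic_sum ns\<^esub> seq_sum (cyclic_sum ns) (image_mset (generator ns L) K)"
    unfolding image_mset_add_mset
    by (rule seq_sum_add_mset) (auto simp: generator_def intro!: residues_closed assms(1))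
  ultimately show ?case by (simp only: add.IH generator_def[of ns L k] residues_add)
qed

text \<open>Subsequences lift to multisets of indices, so a zero sum becomes a system of
  divisibilities in the multiplicities, even when different indices name equal elements.\<close>

lemma zero_sum_free_generators:
  assumes "\<forall>n \<in> set ns. 0 < n" "linear_map L"
    and "\<And>K'. K' \<subseteq># K \<Longrightarrow> \<forall>i<length ns. int (ns ! i) dvd L (\<lambda>k. int (count K' k)) i \<Longrightarrow> K' = {#}"
  shows "zero_sum_free (cyclic_sum ns) (image_mset (generator ns L) K)"
  unfolding zero_sum_free_def seq_over_def
proof (intro conjI allI impI)
  show "set_mset (image_mset (generator ns L) K) \<subseteq> carrier (cyclic_sum ns)"
    by (auto simp: generator_def intro!: residues_closed assms(1))
next
  fix T assume T: "T \<subseteq># image_mset (generator ns L) K \<and> T \<noteq> {#}"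
  then obtain K' where K': "K' \<subseteq># K" "T = image_mset (generator ns L) K'"
    by (metis image_mset_eq_plusD mset_subset_eq_add_left subset_mset.le_iff_add)
  then show "seq_sum (cyclic_sum ns) T \<noteq> \<one>\<^bsub>cyclic_sum ns\<^esub>"
    using assms(3)[OF K'(1)] T seq_sum_generators[OF assms(1,2)] residues_eq_one_iff by auto
qed

lemma zero_sum_free_subset:
  assumes "zero_sum_free G S" "T \<subseteq># S"
  shows "zero_sum_free G T"
  using assms unfolding zero_sum_free_def seq_over_def
  by (meson set_mset_mono subset_mset.order_trans subset_trans)

section \<open>Unit vectors and the exact rank\<close>

lemma generate_unit_vectors:
  assumes pos: "\<forall>n \<in> set ns. 0 < n"
  shows "generate (cyclic_sum ns) ((\<lambda>k. residues ns (\<lambda>i. if i = k then 1 else 0)) ` {..<length ns}) =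
    carrier (cyclic_sum ns)" (is "generate ?G ?A = _")
proof
  interpret comm_group ?G by (rule comm_group_cyclic_sum)
  show "generate ?G ?A \<subseteq> carrier ?G"
    by (rule generate_incl) (auto intro: residues_closed[OF pos])
  have multiple: "residues ns (\<lambda>i. if i = k then int c else 0) \<in> generate ?G ?A" if "k < length ns" for k c
  proof (induction c)
    case 0
    have "residues ns (\<lambda>i. if i = k then int 0 else 0) = \<one>\<^bsub>?G\<^esub>" by (simp add: residues_eq_one_iff)
    then show ?case by (simp add: generate.one)
  next
    case (Suc c)
    have "residues ns (\<lambda>i. if i = k then 1 else 0) \<in> generate ?G ?A"
      using that by (auto intro: generate.incl)
    then have "residues ns (\<lambda>i. if i = k then 1 else 0) \<otimes>\<^bsub>?G\<^esub> residues ns (\<lambda>i. if i = k then int c else 0)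
      \<in> generate ?G ?A" using Suc by (rule generate.eng)
    moreover have "(\<lambda>i. (if i = k then 1 else 0) + (if i = k then int c else 0)) =
      (\<lambda>i. if i = k then int (Suc c) else 0)" by auto
    ultimately show ?case by (simp only: residues_add)
  qed
  \<comment> \<open>Coordinates are filled in one at a time by multiples of single unit
    vectors.\<close>
  have partial: "residues ns (\<lambda>i. if i < l then int (v i) else 0) \<in> generate ?G ?A"
    if "l \<le> length ns" for l and v :: "nat \<Rightarrow> nat"
    using that
  proof (induction l)
    case 0
    have "residues ns (\<lambda>i. if i < 0 then int (v i) else 0) = \<one>\<^bsub>?G\<^esub>" by (simp add: residues_eq_one_iff)
    then show ?case by (simp add: generate.one)
  next
    case (Suc l)
    then have "residues ns (\<lambda>i. if i < l then int (v i) else 0) \<otimes>\<^bsub>?G\<^esub>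
        residues ns (\<lambda>i. if i = l then int (v l) else 0) \<in> generate ?G ?A"
      by (intro generate.eng multiple) auto
    moreover have "(\<lambda>i. (if i < l then int (v i) else 0) + (if i = l then int (v l) else 0)) =
      (\<lambda>i. if i < Suc l then int (v i) else 0)" by (auto simp: less_Suc_eq)
    ultimately show ?case by (simp only: residues_add)
  qed
  show "carrier ?G \<subseteq> generate ?G ?A"
  proof
    fix x assume x: "x \<in> carrier ?G"
    then have "\<forall>i<length ns. 0 \<le> x i" by (auto simp: carrier_cyclic_sum[OF pos] PiE_iff)
    then have "residues ns x = residues ns (\<lambda>i. if i < length ns then int (nat (x i)) else 0)"
      by (auto simp: residues_def intro!: restrict_ext)
    then show "x \<in> generate ?G ?A"
      using partial[of "length ns" "\<lambda>i. nat (x i)"] residues_carrier[OF pos x] by simp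
  qed
qed

lemma group_rank_cyclic_sum:
  assumes pos: "\<forall>n \<in> set ns. 0 < n" and p: "p > 1" "\<forall>n \<in> set ns. p dvd n"
  shows "group_rank (cyclic_sum ns) = length ns"
proof -
  let ?G = "cyclic_sum ns"
  let ?Q = "\<lambda>k. \<exists>A. A \<subseteq> carrier ?G \<and> finite A \<and> card A = k \<and> generate ?G A = carrier ?G"
  let ?A = "(\<lambda>k. residues ns (\<lambda>i. if i = k then 1 else 0)) ` {..<length ns}"
  have Q: "?Q (card ?A)"
    using generate_unit_vectors[OF pos] residues_closed[OF pos] by (intro exI[of _ ?A]) auto
  have "(LEAST k. ?Q k) \<le> card ?A" using Q by (rule Least_le)
  also have "\<dots> \<le> length ns" using card_image_le[of "{..<length ns}"] by simp
  finally have "group_rank ?G \<le> length ns" by (simp add: group_rank_def)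
  moreover have "?Q (group_rank ?G)" unfolding group_rank_def using Q by (rule LeastI)
  ultimately show ?thesis using rank_lower_bound[OF pos p] by (metis antisym)
qed

section \<open>Arithmetic behind the construction\<close>

text \<open>
  Zero-sum freeness of the length-12 sequence over \<open>C\<^sub>3\<^sup>3 \<oplus> C\<^sub>6\<close>, which was found by computer search.
  Every term has an odd last coordinate, so only subsequences of even length are at stake.
\<close>

lemma seven_coefficients_zero:
  fixes c1 c2 c3 c4 c5 c6 c7 :: int
  assumes "0 \<le> c1" "c1 \<le> 2" "0 \<le> c2" "c2 \<le> 2" "0 \<le> c3" "c3 \<le> 2" "0 \<le> c4" "c4 \<le> 2"
    and "0 \<le> c5" "c5 \<le> 2" "0 \<le> c6" "c6 \<le> 1" "0 \<le> c7" "c7 \<le> 1"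
    and "3 dvd c1 + c6 + c7" "3 dvd c2 + c5 + c6 - c7" "3 dvd c3 + c5 - c6 - c7"
    and "6 dvd c4 + 3 * (c1 + c2 + c3) + c5 - c6 + c7"
  shows "c1 = 0 \<and> c2 = 0 \<and> c3 = 0 \<and> c4 = 0 \<and> c5 = 0 \<and> c6 = 0 \<and> c7 = 0"
proof -
  have "c5 = 0 \<or> c5 = 1 \<or> c5 = 2" "c6 = 0 \<or> c6 = 1" "c7 = 0 \<or> c7 = 1"
    "c1 = 0 \<or> c1 = 1 \<or> c1 = 2" "c2 = 0 \<or> c2 = 1 \<or> c2 = 2" "c3 = 0 \<or> c3 = 1 \<or> c3 = 2"
    "c4 = 0 \<or> c4 = 1 \<or> c4 = 2"
    using assms(1-14) by presburger+
  \<comment> \<open>A finite check over the 3^5 * 2^2 = 972 coefficient vectors in the box.\<close>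
  then show ?thesis using assms(15-18) by (elim disjE) simp_all
qed

text \<open>Modulo \<open>p\<close> only the summand of \<open>p\<close> survives, since all other
  cofactors contain \<open>p\<close>; its own cofactor is coprime to \<open>p\<close>. Thus elements
  of distinct prime orders in one cyclic group are independent.\<close>

lemma dvd_prod_cofactor_sum:
  fixes P :: "nat set" and b :: "nat \<Rightarrow> nat"
  assumes P: "finite P" "\<forall>p \<in> P. Factorial_Ring.prime p"
    and dvd: "int (\<Prod>P) dvd (\<Sum>p\<in>P. int (\<Prod>P div p) * int (b p))" and p: "p \<in> P"
  shows "p dvd b p"
proof -
  have cofactor: "\<Prod>P div p' = \<Prod>(P - {p'})" if "p' \<in> P" for p'
    using P that by (simp add: prod.remove[OF P(1) that] prime_gt_0_nat)
  have "\<Prod>P dvd (\<Sum>p\<in>P. (\<Prod>P div p) * b p)"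
    using dvd by (simp only: of_nat_mult[symmetric] of_nat_sum[symmetric] of_nat_dvd_iff)
  then have "p dvd (\<Sum>p\<in>P. (\<Prod>P div p) * b p)"
    using P(1) p by (meson dvd_prodI dvd_trans)
  moreover have "p dvd (\<Sum>p'\<in>P - {p}. (\<Prod>P div p') * b p')"
  proof (rule dvd_sum)
    fix p' assume p': "p' \<in> P - {p}"
    then have "p dvd \<Prod>(P - {p'})" using P(1) p by (intro dvd_prodI) auto
    then show "p dvd (\<Prod>P div p') * b p'" using cofactor p' by simp
  qed
  ultimately have "p dvd \<Prod>(P - {p}) * b p"
    unfolding sum.remove[OF P(1) p, of "\<lambda>p. (\<Prod>P div p) * b p"] cofactor[OF p]
    by (simp only: dvd_add_left_iff)
  moreover have "coprime p (\<Prod>(P - {p}))"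
    using P p by (intro prod_coprime_right) (auto intro: primes_coprime)
  ultimately show ?thesis by (simp add: coprime_dvd_mult_right_iff)
qed

text \<open>Bounds the number of terms placed in the first summand by m - 1, where m is the product.
  The induction step uses that the product over \<open>P\<close> is at least 1.\<close>

lemma sum_pred_le_prod:
  fixes P :: "nat set"
  assumes "finite P" "\<forall>p \<in> P. 0 < p"
  shows "(\<Sum>p\<in>P. p - 1) + 1 \<le> \<Prod>P"
  using assms
proof (induction P rule: finite_induct)
  case (insert p P)
  then obtain k where k: "p = Suc k" by (auto simp: gr0_conv_Suc)
  have IH: "(\<Sum>p\<in>P. p - 1) + 1 \<le> \<Prod>P" using insert by simp
  then have "k * 1 \<le> k * \<Prod>P" by (intro mult_le_mono2) linarith
  moreover have "(\<Sum>p\<in>insert p P. p - 1) = k + (\<Sum>p\<in>P. p - 1)" "\<Prod>(insert p P) = \<Prod>P + k * \<Prod>P"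
    using insert.hyps k by simp_all
  ultimately show ?case using IH by linarith
qed simp

lemma size_sum_multiset:
  fixes f :: "'a \<Rightarrow> 'b multiset"
  shows "finite A \<Longrightarrow> size (\<Sum>i\<in>A. f i) = (\<Sum>i\<in>A. size (f i))"
  by (induction A rule: finite_induct) auto

lemma ex_submset_size: "n \<le> size M \<Longrightarrow> \<exists>N. N \<subseteq># M \<and> size N = n"
proof (induction M arbitrary: n)
  case (add x M)
  show ?case
  proof (cases n)
    case (Suc k)
    then obtain N where "N \<subseteq># M" "size N = k" using add by auto
    then show ?thesis using Suc by (intro exI[of _ "add_mset x N"]) simp
  qed (auto intro: exI[of _ "{#}"])
qed simp

section \<open>The group and its linear forms\<close>

text \<open>In the notation of the overview \<open>q = s - 3\<close>: the \<open>q\<close> copies of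
  \<open>m\<close> are the first summand, at coordinate 0, and the \<open>s - 4\<close> copies in
  \<open>G'\<close>.\<close>

definition moduli :: "nat \<Rightarrow> nat \<Rightarrow> nat list" where
  "moduli q m = replicate q m @ [3 * m, 3 * m, 3 * m, 6 * m]"

lemma invariant_chain_moduli: "m > 1 \<Longrightarrow> invariant_chain (moduli q m)"
proof -
  have "sorted_wrt (dvd) (replicate q m)" by (induction q) auto
  then show "m > 1 \<Longrightarrow> invariant_chain (moduli q m)"
    by (auto simp: invariant_chain_def moduli_def sorted_wrt_append)
qed

lemma length_moduli: "length (moduli q m) = q + 4"
  by (simp add: moduli_def)

lemma nth_moduli:
  "i < q \<Longrightarrow> moduli q m ! i = m" "moduli q m ! q = 3 * m"
  "moduli q m ! Suc q = 3 * m" "moduli q m ! Suc (Suc q) = 3 * m"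
  "moduli q m ! (q + 3) = 6 * m"
  by (simp_all add: moduli_def nth_append)

lemma sum_moduli:
  "(\<Sum>n\<leftarrow>moduli q m. n - 1) = q * (m - 1) + 3 * (3 * m - 1) + (6 * m - 1)"
  by (simp add: moduli_def sum_list_replicate)

text \<open>
  Index \<open>Inl p\<close> stands for the element of order \<open>p\<close> in the first summand, \<open>Inr j\<close> for \<open>g\<^sub>j\<close>. The
  coefficients \<open>c\<^sub>1, \<dots>, c\<^sub>7\<close> of \<open>seven_coefficients_zero\<close> sit at the indices
  \<open>q, q + 1, q + 2, q + 3, 1, 2, 3\<close>.
\<close>

definition forms :: "nat set \<Rightarrow> nat \<Rightarrow> (nat + nat \<Rightarrow> int) \<Rightarrow> nat \<Rightarrow> int" where
  "forms P q b i =
    (if i = 0 then \<Sum>p\<in>P. int (\<Prod>P div p) * b (Inl p)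
     else if i < q then b (Inr i)
     else if i = q then b (Inr q) + b (Inr 2) + b (Inr 3)
     else if i = q + 1 then b (Inr (q + 1)) + b (Inr 1) + b (Inr 2) - b (Inr 3)
     else if i = q + 2 then b (Inr (q + 2)) + b (Inr 1) - b (Inr 2) - b (Inr 3)
     else b (Inr (q + 3)) + 3 * (b (Inr q) + b (Inr (q + 1)) + b (Inr (q + 2)))
       + b (Inr 1) - b (Inr 2) + b (Inr 3))"

lemma linear_map_forms: "linear_map (forms P q)"
  unfolding linear_map_def forms_def by (auto simp: fun_eq_iff sum.distrib distrib_left)

text \<open>The multiplicities a_j of the overview. For \<open>q >= 4\<close> they add up to 2 + 1 +
  1 + 4 * 2 = 12 over \<open>1 <= j < q + 4\<close>, and the indices from 4 to \<open>q - 1\<close>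
  are the padding.\<close>

definition base_mult :: "nat \<Rightarrow> nat \<Rightarrow> nat" where
  "base_mult q j = (if j = 1 \<or> q \<le> j then 2 else if j = 2 \<or> j = 3 then 1 else 0)"

text \<open>Coordinates 1 to \<open>q - 1\<close> force \<open>m\<close> to divide their own
  coefficients, and the last four coordinates then force it for the rest. After division by
  \<open>m\<close>, \<open>seven_coefficients_zero\<close> handles the seven essential coefficients;
  a padding coefficient is a multiple of \<open>m\<close> below \<open>m\<close>, hence 0.\<close>

lemma forms_box_trivial:
  fixes b :: "nat + nat \<Rightarrow> nat"
  assumes q: "q \<ge> 4" and m: "m > 0"
    and box: "\<And>j. 1 \<le> j \<Longrightarrow> j < q + 4 \<Longrightarrow> b (Inr j) < (base_mult q j + 1) * m"
    and dvd: "\<And>i. i < q + 4 \<Longrightarrow> int (moduli q m ! i) dvd forms P q (\<lambda>k. int (b k)) i"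
    and j: "1 \<le> j" "j < q + 4"
  shows "b (Inr j) = 0"
proof -
  define B where "B j = int (b (Inr j))" for j
  have small: "int m dvd B j" if "1 \<le> j" "j < q" for j
    using dvd[of j] that by (simp add: forms_def nth_moduli B_def)
  have d123: "int m dvd B 1" "int m dvd B 2" "int m dvd B 3" using small q by auto
  have eq0: "3 * int m dvd B q + B 2 + B 3"
    and eq1: "3 * int m dvd B (q + 1) + B 1 + B 2 - B 3"
    and eq2: "3 * int m dvd B (q + 2) + B 1 - B 2 - B 3"
    and eq3: "6 * int m dvd B (q + 3) + 3 * (B q + B (q + 1) + B (q + 2)) + B 1 - B 2 + B 3"
    using dvd[of q] dvd[of "q + 1"] dvd[of "q + 2"] dvd[of "q + 3"] q
    by (simp_all add: forms_def nth_moduli B_def)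
  have m_dvd: "int m dvd x" if "3 * int m dvd x \<or> 6 * int m dvd x" for x
    using that by (auto dest: dvd_mult_right)
  obtain c1 where c1: "B 1 = int m * c1" using d123(1) by blast
  obtain c2 where c2: "B 2 = int m * c2" using d123(2) by blast
  obtain c3 where c3: "B 3 = int m * c3" using d123(3) by blast
  obtain e0 where "B q + B 2 + B 3 = int m * e0" using m_dvd eq0 by blast
  then have d0: "B q = int m * (e0 - c2 - c3)" unfolding c2 c3 by (simp add: algebra_simps)
  obtain e1 where "B (q + 1) + B 1 + B 2 - B 3 = int m * e1" using m_dvd eq1 by blast
  then have d1: "B (q + 1) = int m * (e1 - c1 - c2 + c3)" unfolding c1 c2 c3 by (simp add: algebra_simps)
  obtain e2 where "B (q + 2) + B 1 - B 2 - B 3 = int m * e2" using m_dvd eq2 by blast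
  then have d2: "B (q + 2) = int m * (e2 - c1 + c2 + c3)" unfolding c1 c2 c3 by (simp add: algebra_simps)
  obtain f0 f1 f2 where f: "B q = int m * f0" "B (q + 1) = int m * f1" "B (q + 2) = int m * f2"
    using d0 d1 d2 by blast
  obtain e3 where "B (q + 3) + 3 * (B q + B (q + 1) + B (q + 2)) + B 1 - B 2 + B 3 = int m * e3"
    using m_dvd eq3 by blast
  then have "B (q + 3) = int m * (e3 - 3 * (f0 + f1 + f2) - c1 + c2 - c3)"
    unfolding c1 c2 c3 f by (simp add: algebra_simps)
  then obtain f3 where f3: "B (q + 3) = int m * f3" by blast
  \<comment> \<open>A multiple of \<open>m\<close> strictly below \<open>(a + 1) * m\<close> has
    quotient at most \<open>a\<close>, which is why \<open>m - 1\<close> extra copies are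
    harmless.\<close>
  have bounds: "0 \<le> c \<and> c \<le> int (base_mult q j)" if "B j = int m * c" "1 \<le> j" "j < q + 4" for j c
  proof -
    have "int m * c < int m * (int (base_mult q j) + 1)"
      using box[OF that(2,3)] that(1) unfolding B_def
      by (metis mult.commute of_nat_1 of_nat_add of_nat_less_iff of_nat_mult)
    moreover have "0 \<le> int m * c" using that(1) by (simp add: B_def flip: that(1))
    ultimately show ?thesis using m by (simp add: zero_le_mult_iff)
  qed
  have b: "0 \<le> f0" "f0 \<le> 2" "0 \<le> f1" "f1 \<le> 2" "0 \<le> f2" "f2 \<le> 2" "0 \<le> f3" "f3 \<le> 2"
    "0 \<le> c1" "c1 \<le> 2" "0 \<le> c2" "c2 \<le> 1" "0 \<le> c3" "c3 \<le> 1"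
    using bounds[OF f(1)] bounds[OF f(2)] bounds[OF f(3)] bounds[OF f3] bounds[OF c1] bounds[OF c2]
      bounds[OF c3] q by (simp_all add: base_mult_def)
  have "int m * 3 dvd int m * (f0 + c2 + c3)" "int m * 3 dvd int m * (f1 + c1 + c2 - c3)"
    "int m * 3 dvd int m * (f2 + c1 - c2 - c3)"
    "int m * 6 dvd int m * (f3 + 3 * (f0 + f1 + f2) + c1 - c2 + c3)"
    using eq0 eq1 eq2 eq3 unfolding c1 c2 c3 f f3 by (simp_all only: algebra_simps)
  then have "3 dvd f0 + c2 + c3" "3 dvd f1 + c1 + c2 - c3" "3 dvd f2 + c1 - c2 - c3"
    "6 dvd f3 + 3 * (f0 + f1 + f2) + c1 - c2 + c3"
    using m by (simp_all only: dvd_mult_cancel_left) auto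
  \<comment> \<open>The quotients \<open>f0, f1, f2, f3, c1, c2, c3\<close> take the places of
    \<open>c1, ..., c7\<close> there, in this order.\<close>
  with b have zero: "f0 = 0 \<and> f1 = 0 \<and> f2 = 0 \<and> f3 = 0 \<and> c1 = 0 \<and> c2 = 0 \<and> c3 = 0"
    by (rule seven_coefficients_zero)
  have "B j = 0"
  proof -
    consider "j = 1" | "j = 2" | "j = 3" | "4 \<le> j" "j < q" | "j = q" | "j = q + 1" | "j = q + 2" | "j = q + 3"
      using j by linarith
    then show ?thesis
    proof cases
      case 4
      then have "int m dvd B j" using small by simp
      moreover have "B j < int m" using box[of j] 4 by (simp add: base_mult_def B_def)
      ultimately show ?thesis by (auto simp: B_def dest: dvd_imp_le)
    qed (simp_all only: c1 c2 c3 f f3 zero mult_zero_right)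
  qed
  then show ?thesis by (simp add: B_def)
qed

section \<open>Cross number and length of the sequence\<close>

lemma cross_number_union: "cross_number G (S + T) = cross_number G S + cross_number G T"
  by (simp add: cross_number_def)

lemma cross_number_nonneg: "0 \<le> cross_number G S"
  by (induction S) (simp_all add: cross_number_def)

lemma cross_number_image_replicates:
  assumes "finite A"
  shows "cross_number G (image_mset f (\<Sum>a\<in>A. replicate_mset (c a) (g a))) =
    (\<Sum>a\<in>A. real (c a) / real (group.ord G (f (g a))))"
  using assms
proof (induction A rule: finite_induct)
  case (insert a A)
  have "cross_number G (replicate_mset n x) = real n / real (group.ord G x)" for n x
    by (induction n) (simp_all add: cross_number_def add_divide_distrib)
  then show ?case using insert by (simp add: cross_number_union)
qed (simp add: cross_number_def)

text \<open>The \<open>base_mult\<close> values add up to 12, so the \<open>q + 3\<close> indices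
  contribute \<open>12 * m + (q + 3) * (m - 1)\<close>. By \<open>sum_moduli\<close> this is one
  more than d* of the group.\<close>

lemma sum_base_mult_box:
  assumes "q \<ge> 4" "m > 0"
  shows "(\<Sum>j=1..<q + 4. (base_mult q j + 1) * m - 1) =
    q * (m - 1) + 3 * (3 * m - 1) + (6 * m - 1) + 1"
proof -
  let ?f = "\<lambda>j. (base_mult q j + 1) * m - 1"
  have "sum ?f {1..<q + 4} = sum ?f {1..<4} + sum ?f {4..<q} + sum ?f {q..<q + 4}"
    using assms(1) by (simp add: sum.atLeastLessThan_concat)
  also have "sum ?f {4..<q} = (\<Sum>j\<in>{4..<q}. m - 1)"
    by (rule sum.cong) (auto simp: base_mult_def)
  also have "sum ?f {1..<4} = (3 * m - 1) + (2 * m - 1) + (2 * m - 1)"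
    using assms(1) by (simp add: numeral_eq_Suc base_mult_def)
  also have "sum ?f {q..<q + 4} = (\<Sum>j\<in>{q..<q + 4}. 3 * m - 1)"
    by (rule sum.cong) (auto simp: base_mult_def)
  finally have *: "sum ?f {1..<q + 4} =
      (3 * m - 1) + (2 * m - 1) + (2 * m - 1) + (q - 4) * (m - 1) + 4 * (3 * m - 1)"
    by simp
  \<comment> \<open>This substitution removes the truncated subtractions.\<close>
  obtain q' m' where "q = q' + 4" "m = Suc m'"
    using assms by (metis add.commute gr0_implies_Suc le_Suc_ex)
  then show ?thesis unfolding * by (simp add: algebra_simps)
qed

lemma zero_sum_free_large_cross_number:
  fixes P :: "nat set"
  assumes q: "q \<ge> 4" and P: "finite P" "P \<noteq> {}" "\<forall>p \<in> P. Factorial_Ring.prime p"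
  defines "G \<equiv> cyclic_sum (moduli q (\<Prod>P))"
  shows "\<exists>S. zero_sum_free G S \<and> size S = d_star G \<and> cross_number G S \<ge> real (card P) / 2"
proof -
  define m where "m = \<Prod>P"
  define ns where "ns = moduli q m"
  define K1 :: "(nat + nat) multiset" where "K1 = (\<Sum>p\<in>P. replicate_mset (p - 1) (Inl p))"
  define K2 :: "(nat + nat) multiset" where
    "K2 = (\<Sum>j=1..<q + 4. replicate_mset ((base_mult q j + 1) * m - 1) (Inr j))"
  let ?g = "generator ns (forms P q)"
  have G: "G = cyclic_sum ns" by (simp add: G_def ns_def m_def)
  have P_pos: "\<forall>p \<in> P. 1 < p" using P(3) prime_gt_1_nat by blast
  have size1: "size K1 + 1 \<le> m"
    using sum_pred_le_prod[OF P(1)] P_pos by (force simp: K1_def size_sum_multiset[OF P(1)] m_def)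
  moreover obtain p where "p \<in> P" using P(2) by blast
  moreover have "1 \<le> size K1"
    unfolding K1_def size_sum_multiset[OF P(1)]
    using \<open>p \<in> P\<close> P_pos P(1) member_le_sum[of p P "\<lambda>p. p - 1"] by fastforce
  ultimately have m: "m > 1" by linarith
  have pos: "\<forall>n \<in> set ns. 0 < n"
    unfolding ns_def by (rule invariant_chain_pos[OF invariant_chain_moduli[OF m]])
  have len: "length ns = q + 4" by (simp add: ns_def length_moduli)
  have ns0: "0 < length ns" "ns ! 0 = m" using q len by (simp_all add: ns_def nth_moduli)
  have d: "d_star G = q * (m - 1) + 3 * (3 * m - 1) + (6 * m - 1)"
    unfolding G ns_def d_star_cyclic_sum[OF invariant_chain_moduli[OF m]]
    by (rule sum_moduli)
  have size2: "size K2 = d_star G + 1"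
    unfolding K2_def d using sum_base_mult_box[OF q, of m] m by (simp add: size_sum_multiset)
  have count1: "count K1 (Inl p) = (if p \<in> P then p - 1 else 0)" "count K1 (Inr j) = 0" for p j
    unfolding K1_def using P(1) by (simp_all add: count_sum)
  have count2: "count K2 (Inr j) = (if j \<in> {1..<q + 4} then (base_mult q j + 1) * m - 1 else 0)"
    "count K2 (Inl p) = 0" for p j
    unfolding K2_def by (simp_all add: count_sum)
  \<comment> \<open>Coordinate 0 involves only \<open>Inl\<close> coefficients and the other
    coordinates only \<open>Inr\<close> ones, so the two kinds are shown to vanish
    separately.\<close>
  have free: "zero_sum_free G (image_mset ?g (K1 + K2))"
    unfolding G
  proof (rule zero_sum_free_generators[OF pos linear_map_forms])
    fix K assume K: "K \<subseteq># K1 + K2"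
      and dvd: "\<forall>i<length ns. int (ns ! i) dvd forms P q (\<lambda>k. int (count K k)) i"
    have le: "count K k \<le> count K1 k + count K2 k" for k
      using mset_subset_eq_count[OF K] by simp
    have "count K k = 0" for k
    proof (cases k)
      case (Inl p)
      show ?thesis
      proof (cases "p \<in> P")
        case True
        have "int m dvd forms P q (\<lambda>k. int (count K k)) 0"
          using dvd ns0 by metis
        then have "p dvd count K (Inl p)"
          by (intro dvd_prod_cofactor_sum[OF P(1,3) _ True]) (simp add: forms_def m_def)
        moreover have "count K (Inl p) < p"
          using le[of "Inl p"] P_pos True by (fastforce simp: count1 count2)
        ultimately show ?thesis using Inl by (auto dest: dvd_imp_le)
      qed (use le[of k] Inl in \<open>simp add: count1 count2\<close>)
    next
      case (Inr j)
      show ?thesis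
      proof (cases "j \<in> {1..<q + 4}")
        case True
        have "count K (Inr j) = 0"
        proof (rule forms_box_trivial[OF q, of m])
          fix j assume "1 \<le> j" "j < q + 4"
          then have "count K (Inr j) \<le> (base_mult q j + 1) * m - 1"
            using le[of "Inr j"] by (simp add: count1 count2)
          moreover have "(base_mult q j + 1) * m > 0" using m by simp
          ultimately show "count K (Inr j) < (base_mult q j + 1) * m" by linarith
        qed (use True dvd len m in \<open>auto simp: ns_def\<close>)
        then show ?thesis using Inr by simp
      qed (use le[of k] Inr in \<open>simp add: count1 count2 split: if_splits\<close>)
    qed
    then show "K = {#}" by (simp add: multiset_eq_iff)
  qed
  have "size K1 \<le> d_star G" using size1 m unfolding d by linarith
  \<comment> \<open>Only terms of \<open>K2\<close> are dropped, so that all of \<open>K1\<close>,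
    the source of the large cross number, stays.\<close>
  obtain K2' where K2': "K2' \<subseteq># K2" "size K2' = d_star G - size K1"
    using ex_submset_size[of "d_star G - size K1" K2] size2 by force
  let ?S = "image_mset ?g (K1 + K2')"
  interpret comm_group G unfolding G by (rule comm_group_cyclic_sum)
  \<comment> \<open>An upper bound is enough, since a smaller order only increases the cross number;
    positivity matters because \<open>1 / 0 = 0\<close>.\<close>
  have ord: "0 < ord (?g (Inl p)) \<and> ord (?g (Inl p)) \<le> p" if p: "p \<in> P" for p
  proof -
    let ?v = "forms P q (\<lambda>j. if j = Inl p then 1 else 0)"
    have v0: "?v 0 = int (m div p)"
      using P(1) p by (simp add: forms_def m_def if_distrib[of "\<lambda>x. _ * x"] cong: if_cong)
    have "p dvd m" using P(1) p by (auto simp: m_def intro: dvd_prodI)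
    then have "int (ns ! i) dvd int p * ?v i" if "i < length ns" for i
    proof (cases "i = 0")
      case True
      have "int p * int (m div p) = int m"
        using \<open>p dvd m\<close> by (simp flip: of_nat_mult)
      then show ?thesis using True v0 ns0 by simp
    qed (use P(1) in \<open>simp add: forms_def\<close>)
    then have "?g (Inl p) [^]\<^bsub>G\<^esub> p = \<one>\<^bsub>G\<^esub>"
      unfolding generator_def G residues_pow residues_eq_one_iff by blast
    moreover have "?g (Inl p) \<in> carrier G"
      unfolding generator_def G by (rule residues_closed[OF pos])
    ultimately have "ord (?g (Inl p)) dvd p" by (simp add: pow_eq_id)
    moreover have "0 < p" using P_pos p by force
    ultimately show ?thesis by (auto intro: dvd_imp_le gr0I)
  qed
  have "real (card P) / 2 = (\<Sum>p\<in>P. 1 / 2)" by simp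
  also have "\<dots> \<le> (\<Sum>p\<in>P. real (p - 1) / real (ord (?g (Inl p))))"
  proof (rule sum_mono)
    fix p assume p: "p \<in> P"
    have "1 / 2 \<le> real (p - 1) / real p" using P_pos p by (force simp: field_simps of_nat_diff)
    also have "\<dots> \<le> real (p - 1) / real (ord (?g (Inl p)))"
      using ord[OF p] by (intro divide_left_mono) (auto intro!: mult_pos_pos)
    finally show "1 / 2 \<le> real (p - 1) / real (ord (?g (Inl p)))" .
  qed
  also have "\<dots> = cross_number G (image_mset ?g K1)"
    unfolding K1_def by (rule cross_number_image_replicates[OF P(1), symmetric])
  also have "\<dots> \<le> cross_number G ?S"
    by (simp add: cross_number_union cross_number_nonneg)
  finally have "real (card P) / 2 \<le> cross_number G ?S" .
  moreover have "zero_sum_free G ?S"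
    using K2'(1) by (intro zero_sum_free_subset[OF free] image_mset_subseteq_mono) simp
  moreover have "size ?S = d_star G" using K2'(2) \<open>size K1 \<le> d_star G\<close> by simp
  ultimately show ?thesis by blast
qed

theorem theorem5p1:
  fixes r :: nat
  assumes "r \<ge> 9"
  shows "(\<forall>M::real. M > 0 \<longrightarrow>
            (\<exists>(G :: (nat \<Rightarrow> int) monoid) S.
               comm_group G \<and> finite (carrier G) \<and> group_rank G = r \<and>
               zero_sum_free G S \<and> size S = d_star G \<and> cross_number G S > M)) \<and>
         \<not> (\<forall>ns S. invariant_chain ns \<and> length ns = r \<and>
               zero_sum_free (cyclic_sum ns) S \<and> size S \<ge> d_star (cyclic_sum ns) \<longrightarrow>
               cross_number (cyclic_sum ns) S \<le> (\<Sum>n\<leftarrow>ns. (real n - 1) / real n))"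
proof -
  have ex: "\<exists>ns S. invariant_chain ns \<and> length ns = r \<and> group_rank (cyclic_sum ns) = r \<and>
      zero_sum_free (cyclic_sum ns) S \<and> size S = d_star (cyclic_sum ns) \<and> cross_number (cyclic_sum ns) S > M"
    for M :: real
  proof -
    \<comment> \<open>The factor 2 matches the contribution of at least 1/2 per prime, and the
      maximum with 1 makes \<open>P\<close> nonempty.\<close>
    obtain t :: nat where t: "real t > 2 * max M 1" using reals_Archimedean2 by blast
    obtain P :: "nat set" where P: "P \<subseteq> {p. Factorial_Ring.prime p}" "finite P" "card P = t"
      using infinite_arbitrarily_large[OF primes_infinite] by blast
    define m where "m = \<Prod>P"
    define ns where "ns = moduli (r - 4) m"
    have "P \<noteq> {}" using t P(3) by auto
    then obtain p where p: "p \<in> P" by blast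
    have "p dvd m" "m > 0"
      using P p by (auto simp: m_def intro: dvd_prodI intro!: prod_pos prime_gt_0_nat)
    then have m: "m > 1"
      using P(1) p by (metis dvd_imp_le less_le_trans mem_Collect_eq prime_gt_1_nat subsetD)
    have chain: "invariant_chain ns" using invariant_chain_moduli[OF m] by (simp add: ns_def)
    have len: "length ns = r" using assms by (simp add: ns_def length_moduli)
    \<comment> \<open>\<open>m\<close> divides every modulus and so serves as the common
      divisor.\<close>
    have "group_rank (cyclic_sum ns) = r"
      using group_rank_cyclic_sum[OF invariant_chain_pos[OF chain] m]
      by (simp add: len) (simp add: ns_def moduli_def)
    moreover have "4 \<le> r - 4" "\<forall>p \<in> P. Factorial_Ring.prime p" using assms P(1) by auto
    moreover obtain S where "zero_sum_free (cyclic_sum ns) S" "size S = d_star (cyclic_sum ns)"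
      "cross_number (cyclic_sum ns) S \<ge> real (card P) / 2"
      using zero_sum_free_large_cross_number[OF calculation(2) P(2) \<open>P \<noteq> {}\<close> calculation(3)]
      unfolding ns_def m_def by blast
    moreover have "real (card P) / 2 > M" using t P(3) by simp
    ultimately show ?thesis using chain len by (intro exI[of _ ns] exI[of _ S]) auto
  qed
  show ?thesis
  proof (intro conjI allI impI notI)
    fix M :: real
    obtain ns S where "invariant_chain ns" "group_rank (cyclic_sum ns) = r"
      "zero_sum_free (cyclic_sum ns) S" "size S = d_star (cyclic_sum ns)" "cross_number (cyclic_sum ns) S > M"
      using ex by blast
    then show "\<exists>(G :: (nat \<Rightarrow> int) monoid) S. comm_group G \<and> finite (carrier G) \<and> group_rank G = r \<and>
        zero_sum_free G S \<and> size S = d_star G \<and> cross_number G S > M"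
      using comm_group_cyclic_sum finite_cyclic_sum[OF invariant_chain_pos] by blast
  next
    assume all: "\<forall>ns S. invariant_chain ns \<and> length ns = r \<and>
        zero_sum_free (cyclic_sum ns) S \<and> size S \<ge> d_star (cyclic_sum ns) \<longrightarrow>
        cross_number (cyclic_sum ns) S \<le> (\<Sum>n\<leftarrow>ns. (real n - 1) / real n)"
    \<comment> \<open>\<open>M = r\<close> is large enough: the conjectured bound is a sum of
      \<open>r\<close> numbers that are at most 1.\<close>
    obtain ns S where S: "invariant_chain ns" "length ns = r"
      "zero_sum_free (cyclic_sum ns) S" "size S = d_star (cyclic_sum ns)"
      "cross_number (cyclic_sum ns) S > real r"
      using ex by blast
    have "(\<Sum>n\<leftarrow>ns. (real n - 1) / real n) \<le> (\<Sum>n\<leftarrow>ns. 1)"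
      by (rule sum_list_mono) (auto simp: divide_le_eq_1)
    also have "\<dots> = real r" using S(2) by (simp add: sum_list_triv)
    finally show False using all S by force
  qed
qed

end
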